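(* There is no polyhedral graph with exactly five faces (the removed undersurface not being counted) whose faces require five colors in order to be colored so that any two distinct faces sharing an edge receive different colors.
   Context: A polyhedral graph (called "cubic graph" for short in the source, where "cubic" refers to a solid figure and not to 3-regularity) is obtained as follows: take the surface of a polyhedron that is topologically a sphere, with its vertices, edges and faces, regarded as a rubber surface with empty interior, and cut off one face, the undersurface. The remaining faces are the faces of the polyhedral graph; the surface can be unfolded into the plane, giving a planar graph with the same adjacencies between faces. Faces are connected open sets, and two faces are adjacent (contiguous) if they share an edge; sharing only vertices does not count. If $v,e,f$ are the numbers of vertices, edges and faces, with the undersurface not counted, then $v-e+f=1$. *)

theory Defs
  imports "HOL-Analysis.Analysis"
begin

text \<open>
  The surface of a polyhedron that is topologically a sphere is given by its finite sets of
  vertices \<open>V\<close>, edges \<open>E\<close> and faces \<open>F\<close>.  Edges and faces are taken without their boundary,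
  so that vertices, edges and faces partition the surface.
\<close>

definition polyhedron_edge :: "(real^3) set \<Rightarrow> (real^3) set \<Rightarrow> bool" where
  "polyhedron_edge V e \<longleftrightarrow> (\<exists>a\<in>V. \<exists>b\<in>V. a \<noteq> b \<and> e = open_segment a b)"

text \<open>
  A face is an open disc in a plane whose boundary is made up of vertices and edges.  That a
  face is a disc, and not an arbitrary connected open set, excludes ring-shaped faces, for
  which Euler's formula fails.
\<close>

definition polyhedron_face ::
  "(real^3) set \<Rightarrow> (real^3) set set \<Rightarrow> (real^3) set \<Rightarrow> bool" where
  "polyhedron_face V E f \<longleftrightarrow>
     aff_dim f = 2 \<and>
     openin (top_of_set (affine hull f)) f \<and>
     f homeomorphic ball (0::real^2) 1 \<and>
     (\<exists>W\<subseteq>V. \<exists>D\<subseteq>E. closure f - f = W \<union> \<Union>D)"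

definition spherical_polyhedron ::
  "(real^3) set \<Rightarrow> (real^3) set set \<Rightarrow> (real^3) set set \<Rightarrow> bool" where
  "spherical_polyhedron V E F \<longleftrightarrow>
     finite V \<and> finite E \<and> finite F \<and>
     (\<forall>e\<in>E. polyhedron_edge V e) \<and>
     (\<forall>f\<in>F. polyhedron_face V E f) \<and>
     pairwise disjnt ((\<lambda>v. {v}) ` V \<union> E \<union> F) \<and>
     (\<forall>e\<in>E. card {f\<in>F. e \<subseteq> closure f} = 2) \<and>
     (V \<union> \<Union>E \<union> \<Union>F) homeomorphic sphere (0::real^3) 1"

text \<open>
  A polyhedral graph arises by cutting off one face \<open>u\<close>, the undersurface; all vertices and
  edges are kept, and \<open>G\<close> is the set of the remaining faces.  The deformation into the plane
  does not affect adjacency and is not performed.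
\<close>

definition polyhedral_graph ::
  "(real^3) set \<Rightarrow> (real^3) set set \<Rightarrow> (real^3) set set \<Rightarrow> bool" where
  "polyhedral_graph V E G \<longleftrightarrow>
     (\<exists>F. \<exists>u\<in>F. spherical_polyhedron V E F \<and> G = F - {u})"

definition adjacent_faces ::
  "(real^3) set set \<Rightarrow> (real^3) set \<Rightarrow> (real^3) set \<Rightarrow> bool" where
  "adjacent_faces E f g \<longleftrightarrow> f \<noteq> g \<and> (\<exists>e\<in>E. e \<subseteq> closure f \<and> e \<subseteq> closure g)"

definition face_colourable ::
  "(real^3) set set \<Rightarrow> (real^3) set set \<Rightarrow> nat \<Rightarrow> bool" where
  "face_colourable E G k \<longleftrightarrow>
     (\<exists>c :: (real^3) set \<Rightarrow> nat.
        (\<forall>f\<in>G. c f < k) \<and>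
        (\<forall>f\<in>G. \<forall>g\<in>G. adjacent_faces E f g \<longrightarrow> c f \<noteq> c g))"

definition requires_colours ::
  "(real^3) set set \<Rightarrow> (real^3) set set \<Rightarrow> nat \<Rightarrow> bool" where
  "requires_colours E G k \<longleftrightarrow>
     face_colourable E G k \<and> (\<forall>m<k. \<not> face_colourable E G m)"

end

theory Submission
  imports Defs
begin

text \<open>
  Five faces that need five colours are pairwise adjacent.  Puncturing the surface at a point of the
  undersurface maps them to the plane, where the midpoint of a common edge is accessible
  from both of its faces, so that the adjacencies give a drawing of \<open>K\<^sub>5\<close>.  A Jordan curve through four of
  the faces \<open>a, d, b, e\<close> (in this cyclic order) leaves three connected sets off the curve: a link
  from \<open>a\<close> to \<open>b\<close>, a link from \<open>d\<close> to \<open>e\<close>, and the fifth face with links to all four.  Any two of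
  them join interlaced parts of the curve and hence lie on different sides of it, which is
  impossible as there are only two sides.
\<close>

section \<open>Separation of the plane by Janiszewski's theorem and by Jordan curves\<close>

text \<open>
  If both \<open>S\<close> and \<open>W\<close> avoided the side \<open>R\<close>, then \<open>R\<close> and \<open>W\<close>, which touch both \<open>P\<close> and \<open>Q\<close>, could be
  joined off \<open>P \<union> S\<close> and off \<open>Q \<union> S\<close>; Janiszewski's theorem would then join them off \<open>J\<close>.
\<close>

lemma crossing_connected_sets_meet:
  fixes J P Q S W R :: "complex set"
  assumes R: "R \<in> components (- J)" "J \<subseteq> closure R"
    and "compact P" "compact Q" "compact S" "connected S"
    and J: "P \<subseteq> J" "Q \<subseteq> J" "J \<subseteq> P \<union> Q \<union> S" "P \<inter> Q \<subseteq> S"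
    and "S \<inter> R = {}"
    and W: "connected W" "W \<inter> J = {}" "W \<inter> S = {}"
    and w: "w \<in> P" "w \<notin> Q \<union> S" "w \<in> closure W"
    and w': "w' \<in> Q" "w' \<notin> P \<union> S" "w' \<in> closure W"
  shows "W \<inter> R \<noteq> {}"
proof
  assume WR: "W \<inter> R = {}"
  have RJ: "R \<subseteq> - J" and "connected R" "R \<noteq> {}"
    using R(1) by (auto simp: in_components_maximal)
  have "W \<noteq> {}" using w by auto
  obtain r t where rt: "r \<in> R" "t \<in> W"
    using \<open>R \<noteq> {}\<close> \<open>W \<noteq> {}\<close> by blast
  \<comment> \<open>Each such \<open>x\<close> lies in the closure of \<open>W\<close>, and also in
    that of \<open>R\<close>, because every point of \<open>J\<close> does. Adding it to both sets
    keeps them connected and glues them together.\<close>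
  have link: "connected_component (- (X \<union> S)) r t"
    if "X \<subseteq> J" "x \<in> J" "x \<notin> X \<union> S" "x \<in> closure W" for X x
  proof -
    have "connected (insert x R)" "connected (insert x W)"
      using connected_intermediate_closure[OF \<open>connected R\<close>, of "insert x R"]
        connected_intermediate_closure[OF \<open>connected W\<close>, of "insert x W"]
        that R(2) closure_subset by blast+
    then have "connected (insert x R \<union> insert x W)"
      by (intro connected_Un) auto
    moreover have "insert x R \<union> insert x W \<subseteq> - (X \<union> S)"
      using that RJ W(2,3) \<open>S \<inter> R = {}\<close> by blast
    ultimately show ?thesis
      using rt by (blast intro: connected_componentI)
  qed
  \<comment> \<open>The sets \<open>P \<union> S\<close> and \<open>Q \<union> S\<close> overlap
    exactly in \<open>S\<close>, because \<open>P\<close> and \<open>Q\<close> meet only there;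
    Janiszewski's theorem needs this overlap to be connected. The link off
    \<open>P \<union> S\<close> passes through \<open>w'\<close>, the one off
    \<open>Q \<union> S\<close> through \<open>w\<close>.\<close>
  have "connected_component (- ((P \<union> S) \<union> (Q \<union> S))) r t"
  proof (rule Janiszewski)
    have "(P \<union> S) \<inter> (Q \<union> S) = S" using J(4) by blast
    then show "connected ((P \<union> S) \<inter> (Q \<union> S))" using \<open>connected S\<close> by simp
    show "compact (P \<union> S)" "closed (Q \<union> S)"
      using assms by (auto simp: compact_imp_closed)
    show "connected_component (- (P \<union> S)) r t" "connected_component (- (Q \<union> S)) r t"
      using link w w' J by blast+
  qed
  then have "connected_component (- J) r t"
    by (rule connected_component_of_subset) (use J in blast)
  then obtain C where C: "connected C" "C \<subseteq> - J" "r \<in> C" "t \<in> C"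
    by (auto simp: connected_component_def)
  then have "C \<subseteq> R"
    using components_maximal[OF R(1)] rt by blast
  then show False using C rt WR by blast
qed

text \<open>Puts the Jordan curve theorem into the form used by the crossing lemma. Each open
  connected side is a component, because a larger connected set off the curve would be split by the
  two open sides; the curve is the frontier of both sides and so lies in both closures.\<close>

lemma Jordan_curve_sides:
  fixes c :: "real \<Rightarrow> complex"
  assumes "simple_path c" "pathfinish c = pathstart c"
  obtains R R' where
    "R \<in> components (- path_image c)" "R' \<in> components (- path_image c)"
    "path_image c \<subseteq> closure R" "path_image c \<subseteq> closure R'"
    "R \<inter> R' = {}" "R \<union> R' = - path_image c"
proof -
  obtain R R' where R: "R \<noteq> {}" "open R" "connected R"
      "R' \<noteq> {}" "open R'" "connected R'"
      "R \<inter> R' = {}" "R \<union> R' = - path_image c"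
      "frontier R = path_image c" "frontier R' = path_image c"
    using Jordan_curve[OF assms] by metis
  have comp: "X \<in> components (- path_image c)"
    if X: "X \<noteq> {}" "open X" "connected X" "open Y" "X \<inter> Y = {}" "X \<union> Y = - path_image c" for X Y
  proof (subst in_components_maximal, intro conjI allI impI)
    fix D assume D: "D \<noteq> {} \<and> X \<subseteq> D \<and> D \<subseteq> - path_image c \<and> connected D"
    then have "X \<inter> D = {} \<or> Y \<inter> D = {}"
      using X connectedD[of D X Y] by blast
    then show "D = X" using D X by blast
  qed (use X in auto)
  show ?thesis
  proof
    show "R \<in> components (- path_image c)" "R' \<in> components (- path_image c)"
      using comp[of R R'] comp[of R' R] R by (auto simp: Int_commute Un_commute)
    show "path_image c \<subseteq> closure R" "path_image c \<subseteq> closure R'"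
      using R(9,10) by (auto simp: frontier_def)
  qed (use R in auto)
qed

text \<open>A path from \<open>x\<close> into \<open>A\<close> is cut at the first time it hits
  \<open>A\<close>. The half-open piece misses \<open>A\<close> but has the hitting point in its
  closure; with that point added it is the image of a closed interval, hence compact and
  connected.\<close>

lemma path_connected_initial_segment:
  fixes X :: "'a::metric_space set"
  assumes "path_connected X" "x \<in> X" "x \<notin> A" "A \<inter> X \<noteq> {}" "closed A"
  obtains T y where "connected T" "x \<in> T" "T \<subseteq> X - A" "y \<in> A \<inter> X" "y \<in> closure T"
    "compact (insert y T)" "connected (insert y T)"
proof -
  obtain z where "z \<in> A" "z \<in> X" using assms by blast
  then obtain g where g: "path g" "path_image g \<subseteq> X" "pathstart g = x" "pathfinish g = z"
    using assms(1,2) unfolding path_connected_def by metis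
  have cont: "continuous_on {0..1} g" using g(1) by (simp add: path_def)
  define B where "B = {0..1} \<inter> g -` A"
  have "closed B" unfolding B_def
    using continuous_on_closed_vimage[of "{0..1}" g] cont \<open>closed A\<close> by (auto simp: Int_commute)
  moreover have "1 \<in> B" using g \<open>z \<in> A\<close> by (auto simp: B_def pathfinish_def)
  moreover have bdd: "bdd_below B" by (rule bdd_belowI[of _ 0]) (auto simp: B_def)
  ultimately have "Inf B \<in> B" by (intro closed_contains_Inf) auto
  define s where "s = Inf B"
  have s: "s \<in> B" "0 \<le> s" "s \<le> 1" "g s \<in> A" using \<open>Inf B \<in> B\<close> by (auto simp: s_def B_def)
  have "s \<noteq> 0" using s(4) g(3) \<open>x \<notin> A\<close> by (auto simp: pathstart_def)
  then have "0 < s" using s by simp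
  have less: "g r \<notin> A" if "0 \<le> r" "r < s" for r
  proof
    assume "g r \<in> A"
    then have "r \<in> B" using that s by (auto simp: B_def)
    then show False using cInf_lower[OF _ bdd] that unfolding s_def by fastforce
  qed
  have cs: "continuous_on {0..s} g"
    using cont continuous_on_subset s by (metis atLeastatMost_subset_iff order_refl)
  have ins: "insert (g s) (g ` {0..<s}) = g ` {0..s}"
    using \<open>0 < s\<close> by (force simp: image_iff le_less)
  have "g ` closure {0..<s} \<subseteq> closure (g ` {0..<s})"
    using cs \<open>0 < s\<close> closure_subset[of "g ` {0..<s}"] by (intro image_closure_subset) simp_all
  then have cl: "g s \<in> closure (g ` {0..<s})"
    using \<open>0 < s\<close> by (auto simp: image_subset_iff)
  show ?thesis
  proof
    show "connected (g ` {0..<s})"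
      by (rule connected_continuous_image) (auto intro: continuous_on_subset[OF cs])
    show "x \<in> g ` {0..<s}"
      using g(3) \<open>0 < s\<close> by (auto simp: pathstart_def image_iff intro!: bexI[of _ 0])
    show "g ` {0..<s} \<subseteq> X - A"
      using less g(2) s(3) by (force simp: path_image_def)
    show "g s \<in> A \<inter> X" using s g(2) by (auto simp: path_image_def)
    show "g s \<in> closure (g ` {0..<s})" by (rule cl)
    show "compact (insert (g s) (g ` {0..<s}))" "connected (insert (g s) (g ` {0..<s}))"
      unfolding ins using cs by (auto intro: compact_continuous_image connected_continuous_image)
  qed
qed

section \<open>Five regions of the plane cannot be pairwise in contact\<close>

text \<open>This is the nonplanarity of \<open>K_5\<close>, with regions as vertices and contact
  points as edges. That a region stays path connected when a contact point is added expresses that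
  the point is accessible from it; by symmetry of \<open>m\<close> it is accessible from both
  regions.\<close>

lemma no_complete_five_contact_in_plane:
  fixes f :: "'a \<Rightarrow> complex set" and m :: "'a \<Rightarrow> 'a \<Rightarrow> complex"
  assumes "card I = 5"
    and ne: "\<And>i. i \<in> I \<Longrightarrow> f i \<noteq> {}"
    and fpc: "\<And>i. i \<in> I \<Longrightarrow> path_connected (f i)"
    and pc: "\<And>i j. \<lbrakk>i \<in> I; j \<in> I; i \<noteq> j\<rbrakk> \<Longrightarrow> path_connected (insert (m i j) (f i))"
    and sym: "\<And>i j. \<lbrakk>i \<in> I; j \<in> I\<rbrakk> \<Longrightarrow> m i j = m j i"
    and disj: "\<And>i j. \<lbrakk>i \<in> I; j \<in> I; i \<noteq> j\<rbrakk> \<Longrightarrow> f i \<inter> f j = {}"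
    and notin: "\<And>i j k. \<lbrakk>i \<in> I; j \<in> I; k \<in> I; i \<noteq> j\<rbrakk> \<Longrightarrow> m i j \<notin> f k"
    and inj: "\<And>i j k l. \<lbrakk>i \<in> I; j \<in> I; k \<in> I; l \<in> I; i \<noteq> j; k \<noteq> l; m i j = m k l\<rbrakk>
                \<Longrightarrow> {i, j} = {k, l}"
  shows False
proof -
  \<comment> \<open>Labelling a point by the regions it belongs to reduces every disjointness claim below to a
    comparison of sets of labels.\<close>
  define L where "L z = {i \<in> I. z \<in> f i \<or> (\<exists>j\<in>I. j \<noteq> i \<and> z = m i j)}" for z
  have Lf: "L z = {i}" if "i \<in> I" "z \<in> f i" for i z
    using that disj notin unfolding L_def by blast
  have Lm: "L (m i j) = {i, j}" if "i \<in> I" "j \<in> I" "i \<noteq> j" for i j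
  proof -
    have "k \<in> {i, j}" if "k \<in> L (m i j)" for k
      using that \<open>i \<in> I\<close> \<open>j \<in> I\<close> \<open>i \<noteq> j\<close> notin inj unfolding L_def by blast
    moreover have "i \<in> L (m i j)" "j \<in> L (m i j)"
      using that sym[of i j] unfolding L_def by auto
    ultimately show ?thesis by blast
  qed
  have sep: "X \<inter> Y = {}" if "L ` X \<subseteq> A" "L ` Y \<subseteq> B" "A \<inter> B = {}" for X Y A B
    using that by blast
  have arcs: "\<exists>g. arc g \<and> pathstart g = m i j \<and> pathfinish g = m i k \<and>
      path_image g \<subseteq> f i \<union> {m i j, m i k} \<and> path_image g \<inter> f i \<noteq> {}"
    if "i \<in> I" "j \<in> I" "k \<in> I" "i \<noteq> j" "i \<noteq> k" "j \<noteq> k" for i j k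
  proof -
    have "path_connected (insert (m i j) (f i) \<union> insert (m i k) (f i))"
      using that pc ne by (intro path_connected_Un) auto
    moreover have "m i j \<noteq> m i k"
      using inj[of i j i k] that by (auto simp: doubleton_eq_iff)
    ultimately obtain g where g: "arc g" "path_image g \<subseteq> insert (m i j) (f i) \<union> insert (m i k) (f i)"
        "pathstart g = m i j" "pathfinish g = m i k"
      unfolding path_connected_arcwise by blast
    \<comment> \<open>An arc is injective, so its value at an inner parameter differs from both ends
      and must lie in the region itself. Tails inside the region therefore have a point of the arc
      to run into.\<close>
    have "g (1/2) \<noteq> g 0" "g (1/2) \<noteq> g 1"
      using g(1) inj_onD[of g "{0..1}" "1/2"] unfolding arc_def by fastforce+
    moreover have "g (1/2) \<in> path_image g" by (auto simp: path_image_def)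
    ultimately have "g (1/2) \<in> path_image g \<inter> f i"
      using g by (auto simp: pathstart_def pathfinish_def)
    then show ?thesis using g by blast
  qed
  \<comment> \<open>From the contact point with region \<open>j\<close>, walk inside region
    \<open>i\<close> until \<open>g\<close> is first met. The landing point \<open>y\<close> is not
    the start, which is off \<open>g\<close>, so it carries the label \<open>{i}\<close>
    only.\<close>
  have tails: "\<exists>T y. connected T \<and> m i j \<in> T \<and> T \<inter> path_image g = {} \<and> L ` T \<subseteq> {{i}, {i, j}} \<and>
      y \<in> path_image g \<and> L y = {i} \<and> y \<in> closure T \<and> compact (insert y T) \<and> connected (insert y T)"
    if "i \<in> I" "j \<in> I" "i \<noteq> j" "m i j \<notin> path_image g" "path_image g \<inter> f i \<noteq> {}" "arc g" for i j g
  proof -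
    note ij = that
    obtain T y where T: "connected T" "m i j \<in> T" "T \<subseteq> insert (m i j) (f i) - path_image g"
        "y \<in> path_image g \<inter> insert (m i j) (f i)" "y \<in> closure T"
        "compact (insert y T)" "connected (insert y T)"
    proof (rule path_connected_initial_segment)
      show "path_connected (insert (m i j) (f i))" "m i j \<in> insert (m i j) (f i)"
          "m i j \<notin> path_image g" "path_image g \<inter> insert (m i j) (f i) \<noteq> {}" "closed (path_image g)"
        using ij pc by (auto simp: closed_arc_image)
    qed
    have "L ` T \<subseteq> {{i}, {i, j}}"
      using T(3) Lf[OF ij(1)] Lm[OF ij(1-3)] by auto
    moreover have "L y = {i}"
      using T(4) ij(4) Lf[OF ij(1)] by auto
    ultimately show ?thesis using T by blast
  qed
  have "finite I" using \<open>card I = 5\<close> card.infinite by fastforce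
  then obtain xs where xs: "set xs = I" "distinct xs" "length xs = 5"
    using finite_distinct_list \<open>card I = 5\<close> distinct_card by metis
  then obtain a b c d e where "xs = [a, b, c, d, e]"
    by (auto simp: length_Suc_conv eval_nat_numeral)
  with xs have I: "a \<in> I" "b \<in> I" "c \<in> I" "d \<in> I" "e \<in> I"
    and dist: "a \<noteq> b" "a \<noteq> c" "a \<noteq> d" "a \<noteq> e" "b \<noteq> c" "b \<noteq> d" "b \<noteq> e" "c \<noteq> d" "c \<noteq> e" "d \<noteq> e"
      "b \<noteq> a" "c \<noteq> a" "d \<noteq> a" "e \<noteq> a" "c \<noteq> b" "d \<noteq> b" "e \<noteq> b" "d \<noteq> c" "e \<noteq> c" "e \<noteq> d"
    by auto
  note neq = dist doubleton_eq_iff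
  obtain ga where ga: "arc ga" "pathstart ga = m a e" "pathfinish ga = m a d"
      "path_image ga \<subseteq> f a \<union> {m a e, m a d}" "path_image ga \<inter> f a \<noteq> {}"
    using arcs[of a e d] I dist by blast
  obtain gd where gd: "arc gd" "pathstart gd = m d a" "pathfinish gd = m d b"
      "path_image gd \<subseteq> f d \<union> {m d a, m d b}" "path_image gd \<inter> f d \<noteq> {}"
    using arcs[of d a b] I dist by blast
  obtain gb where gb: "arc gb" "pathstart gb = m b d" "pathfinish gb = m b e"
      "path_image gb \<subseteq> f b \<union> {m b d, m b e}" "path_image gb \<inter> f b \<noteq> {}"
    using arcs[of b d e] I dist by blast
  obtain ge where ge: "arc ge" "pathstart ge = m e b" "pathfinish ge = m e a"
      "path_image ge \<subseteq> f e \<union> {m e b, m e a}" "path_image ge \<inter> f e \<noteq> {}"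
    using arcs[of e b a] I dist by blast
  have Larc: "L ` X \<subseteq> {{i}, {i, j}, {i, k}}"
    if "X \<subseteq> f i \<union> {m i j, m i k}" "i \<in> I" "j \<in> I" "k \<in> I" "i \<noteq> j" "i \<noteq> k" for X i j k
  proof -
    have "L ` f i \<subseteq> {{i}}"
      using Lf[OF that(2)] by blast
    then have "L ` (f i \<union> {m i j, m i k}) \<subseteq> {{i}} \<union> {{i, j}, {i, k}}"
      unfolding image_Un image_insert image_empty Lm[OF that(2,3,5)] Lm[OF that(2,4,6)]
      by (rule Un_mono) simp
    from order_trans[OF image_mono[OF that(1)] this] show ?thesis
      by (simp only: Un_insert_left Un_empty_left)
  qed
  have La: "L ` path_image ga \<subseteq> {{a}, {a, e}, {a, d}}"
    and Lb: "L ` path_image gb \<subseteq> {{b}, {b, d}, {b, e}}"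
    and Ld: "L ` path_image gd \<subseteq> {{d}, {d, a}, {d, b}}"
    and Le: "L ` path_image ge \<subseteq> {{e}, {e, b}, {e, a}}"
    using Larc ga(4) gb(4) gd(4) ge(4) I dist by simp_all
  have syms: "m d a = m a d" "m b d = m d b" "m e b = m b e" "m e a = m a e"
    using sym I by auto
  \<comment> \<open>A common point other than \<open>m i j\<close> would have the label
    \<open>{i}\<close> or \<open>{i, k}\<close> from the first arc and \<open>{j}\<close> or
    \<open>{j, l}\<close> from the second, and these never agree.\<close>
  have meet: "path_image g \<inter> path_image h \<subseteq> {m i j}"
    if "path_image g \<subseteq> f i \<union> {m i k, m i j}" "path_image h \<subseteq> f j \<union> {m i j, m j l}"
      "i \<in> I" "j \<in> I" "k \<in> I" "l \<in> I" "i \<noteq> j" "k \<noteq> i" "l \<noteq> j" "k \<noteq> j" "l \<noteq> i" for g h i j k l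
  proof
    fix z assume "z \<in> path_image g \<inter> path_image h"
    then have "z \<in> f i \<or> z = m i k \<or> z = m i j" "z \<in> f j \<or> z = m j l \<or> z = m i j"
      using that(1,2) by auto
    moreover have "L (m i k) = {i, k}" "L (m j l) = {j, l}" using Lm that by auto
    moreover have "{i} \<noteq> {j}" "{i} \<noteq> {j, l}" "{i, k} \<noteq> {j}" "{i, k} \<noteq> {j, l}"
      using that by (auto simp: doubleton_eq_iff)
    ultimately show "z \<in> {m i j}"
      using Lf[OF that(3), of z] Lf[OF that(4), of z] by (metis singletonI)
  qed
  have meets: "path_image ga \<inter> path_image gd \<subseteq> {m a d}" "path_image gd \<inter> path_image gb \<subseteq> {m d b}"
      "path_image gb \<inter> path_image ge \<subseteq> {m b e}" "path_image ge \<inter> path_image ga \<subseteq> {m e a}"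
    using meet[of ga a e d gd b] meet[of gd d a b gb e] meet[of gb b d e ge a] meet[of ge e b a ga d]
      ga(4) gb(4) gd(4) ge(4) I dist unfolding syms by (auto simp: insert_commute)
  have ab: "path_image ga \<inter> path_image gb = {}" and de: "path_image gd \<inter> path_image ge = {}"
    by (rule sep[OF La Lb], simp add: neq, rule sep[OF Ld Le], simp add: neq)
  \<comment> \<open>The Jordan curve runs cyclically through the regions a, d, b, e.\<close>
  let ?h = "ga +++ gd +++ gb"
  let ?J = "path_image ga \<union> path_image gd \<union> path_image gb \<union> path_image ge"
  have J: "path_image (?h +++ ge) = ?J"
    using ga gd gb ge syms by (simp add: path_image_join Un_assoc)
  \<comment> \<open>Consecutive arcs meet only in their contact point and opposite ones not at all,
    so three of them form an arc, which \<open>ge\<close> closes to a simple loop.\<close>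
  have "arc ?h"
    using ga gd gb meets(1,2) ab syms
    by (intro arc_join) (simp_all add: path_image_join Int_Un_distrib)
  moreover have "path_image ?h \<inter> path_image ge \<subseteq> {m a e, m b e}"
    using ga gd gb meets(3,4) de syms by (auto simp: path_image_join)
  ultimately have loop: "simple_path (?h +++ ge)" "pathfinish (?h +++ ge) = pathstart (?h +++ ge)"
    using ga gd gb ge syms by (auto intro!: simple_path_join_loop)
  obtain R R' where R: "R \<in> components (- ?J)" "R' \<in> components (- ?J)"
      "?J \<subseteq> closure R" "?J \<subseteq> closure R'" "R \<inter> R' = {}" "R \<union> R' = - ?J"
    using Jordan_curve_sides[OF loop] unfolding J by metis
  have not_in: "z \<notin> X" if "L ` X \<subseteq> K" "L z \<notin> K" for z X K
    using that by blast
  have not_on: "m i j \<notin> X" if "i \<in> I" "j \<in> I" "i \<noteq> j" "L ` X \<subseteq> K" "{i, j} \<notin> K" for i j X K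
  proof
    assume "m i j \<in> X"
    then have "L (m i j) \<in> K" using that(4) by blast
    then show False using Lm[OF that(1-3)] that(5) by simp
  qed

  \<comment> \<open>Tails from the remaining contact points to the curve\<close>
  have off_ab: "m a b \<notin> path_image ga"
    by (rule not_on[OF I(1) I(2) _ La]) (simp_all add: neq)
  have off_ac: "m a c \<notin> path_image ga"
    by (rule not_on[OF I(1) I(3) _ La]) (simp_all add: neq)
  have off_ba: "m b a \<notin> path_image gb"
    by (rule not_on[OF I(2) I(1) _ Lb]) (simp_all add: neq)
  have off_bc: "m b c \<notin> path_image gb"
    by (rule not_on[OF I(2) I(3) _ Lb]) (simp_all add: neq)
  have off_de: "m d e \<notin> path_image gd"
    by (rule not_on[OF I(4) I(5) _ Ld]) (simp_all add: neq)
  have off_dc: "m d c \<notin> path_image gd"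
    by (rule not_on[OF I(4) I(3) _ Ld]) (simp_all add: neq)
  have off_ed: "m e d \<notin> path_image ge"
    by (rule not_on[OF I(5) I(4) _ Le]) (simp_all add: neq)
  have off_ec: "m e c \<notin> path_image ge"
    by (rule not_on[OF I(5) I(3) _ Le]) (simp_all add: neq)
  obtain Tab yab where Tab: "connected Tab" "m a b \<in> Tab" "Tab \<inter> path_image ga = {}"
      "L ` Tab \<subseteq> {{a}, {a, b}}" "yab \<in> path_image ga" "L yab = {a}" "yab \<in> closure Tab"
      "compact (insert yab Tab)" "connected (insert yab Tab)"
    using tails[OF I(1) I(2) _ off_ab ga(5,1)] dist by blast
  obtain Tac yac where Tac: "connected Tac" "m a c \<in> Tac" "Tac \<inter> path_image ga = {}"
      "L ` Tac \<subseteq> {{a}, {a, c}}" "yac \<in> path_image ga" "L yac = {a}" "yac \<in> closure Tac"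
      "compact (insert yac Tac)" "connected (insert yac Tac)"
    using tails[OF I(1) I(3) _ off_ac ga(5,1)] dist by blast
  obtain Tba yba where Tba: "connected Tba" "m b a \<in> Tba" "Tba \<inter> path_image gb = {}"
      "L ` Tba \<subseteq> {{b}, {b, a}}" "yba \<in> path_image gb" "L yba = {b}" "yba \<in> closure Tba"
      "compact (insert yba Tba)" "connected (insert yba Tba)"
    using tails[OF I(2) I(1) _ off_ba gb(5,1)] dist by blast
  obtain Tbc ybc where Tbc: "connected Tbc" "m b c \<in> Tbc" "Tbc \<inter> path_image gb = {}"
      "L ` Tbc \<subseteq> {{b}, {b, c}}" "ybc \<in> path_image gb" "L ybc = {b}" "ybc \<in> closure Tbc"
      "compact (insert ybc Tbc)" "connected (insert ybc Tbc)"
    using tails[OF I(2) I(3) _ off_bc gb(5,1)] dist by blast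
  obtain Tde yde where Tde: "connected Tde" "m d e \<in> Tde" "Tde \<inter> path_image gd = {}"
      "L ` Tde \<subseteq> {{d}, {d, e}}" "yde \<in> path_image gd" "L yde = {d}" "yde \<in> closure Tde"
      "compact (insert yde Tde)" "connected (insert yde Tde)"
    using tails[OF I(4) I(5) _ off_de gd(5,1)] dist by blast
  obtain Tdc ydc where Tdc: "connected Tdc" "m d c \<in> Tdc" "Tdc \<inter> path_image gd = {}"
      "L ` Tdc \<subseteq> {{d}, {d, c}}" "ydc \<in> path_image gd" "L ydc = {d}" "ydc \<in> closure Tdc"
      "compact (insert ydc Tdc)" "connected (insert ydc Tdc)"
    using tails[OF I(4) I(3) _ off_dc gd(5,1)] dist by blast
  obtain Ted yed where Ted: "connected Ted" "m e d \<in> Ted" "Ted \<inter> path_image ge = {}"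
      "L ` Ted \<subseteq> {{e}, {e, d}}" "yed \<in> path_image ge" "L yed = {e}" "yed \<in> closure Ted"
      "compact (insert yed Ted)" "connected (insert yed Ted)"
    using tails[OF I(5) I(4) _ off_ed ge(5,1)] dist by blast
  obtain Tec yec where Tec: "connected Tec" "m e c \<in> Tec" "Tec \<inter> path_image ge = {}"
      "L ` Tec \<subseteq> {{e}, {e, c}}" "yec \<in> path_image ge" "L yec = {e}" "yec \<in> closure Tec"
      "compact (insert yec Tec)" "connected (insert yec Tec)"
    using tails[OF I(5) I(3) _ off_ec ge(5,1)] dist by blast
  \<comment> \<open>Off the curve, A links its arcs in a and b, B links its arcs in d and e, and C links the fifth
    region c to all four arcs.  C splits into C1 and C2 because only C2 need be disjoint from A, and
    only C1 from B: two tails inside the same region may meet.\<close>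
  define A where "A = Tab \<union> Tba"
  define B where "B = Tde \<union> Ted"
  define C0 where "C0 = f c \<union> {m a c, m b c, m d c, m e c}"
  define C1 where "C1 = C0 \<union> Tac \<union> Tbc"
  define C2 where "C2 = C0 \<union> Tdc \<union> Tec"
  define C where "C = C1 \<union> C2"
  have conn: "connected A" "connected B"
    unfolding A_def B_def using Tab(1,2) Tba(1,2) Tde(1,2) Ted(1,2) sym[of a b] sym[of d e] I
    by (auto intro!: connected_Un)
  have arm: "connected (insert (m i c) (f c))" if "i \<in> I" "i \<noteq> c" for i
    using that pc[of c i] sym[of c i] I by (auto intro: path_connected_imp_connected)
  have "connected ((insert (m a c) (f c) \<union> insert (m b c) (f c)) \<union>
      (insert (m d c) (f c) \<union> insert (m e c) (f c)))"
    using ne[of c] I dist by (intro connected_Un arm) auto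
  also have "\<dots> = C0" unfolding C0_def by blast
  finally have "connected C0" .
  then have connC: "connected C1" "connected C2"
    unfolding C1_def C2_def using Tac(1,2) Tbc(1,2) Tdc(1,2) Tec(1,2)
    by (intro connected_Un; auto simp: C0_def)+
  then have "connected C"
    unfolding C_def using ne[of c] I by (intro connected_Un) (auto simp: C1_def C2_def C0_def)
  have LA: "L ` A \<subseteq> {{a}, {a, b}} \<union> {{b}, {b, a}}"
    and LB: "L ` B \<subseteq> {{d}, {d, e}} \<union> {{e}, {e, d}}"
    unfolding A_def B_def image_Un by (intro Un_mono Tab(4) Tba(4) Tde(4) Ted(4))+
  have "L ` f c \<subseteq> {{c}}"
    using Lf[OF I(3)] by blast
  then have LC0: "L ` C0 \<subseteq> {{c}} \<union> {{a, c}, {b, c}, {d, c}, {e, c}}"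
    unfolding C0_def image_Un by (intro Un_mono) (simp_all add: Lm I dist)
  have LC1: "L ` C1 \<subseteq> ({{c}} \<union> {{a, c}, {b, c}, {d, c}, {e, c}}) \<union> {{a}, {a, c}} \<union> {{b}, {b, c}}"
    and LC2: "L ` C2 \<subseteq> ({{c}} \<union> {{a, c}, {b, c}, {d, c}, {e, c}}) \<union> {{d}, {d, c}} \<union> {{e}, {e, c}}"
    unfolding C1_def C2_def image_Un by (intro Un_mono LC0 Tac(4) Tbc(4) Tdc(4) Tec(4))+
  have disjT: "T \<inter> X = {}" if "L ` T \<subseteq> {{i}, {i, j}}" "L ` X \<subseteq> K" "{{i}, {i, j}} \<inter> K = {}" for T X i j K
    using sep that by blast
  have Tab_J: "Tab \<inter> ?J = {}"
    using disjT[OF Tab(4) Lb] disjT[OF Tab(4) Ld] disjT[OF Tab(4) Le] Tab(3)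
    by (simp add: neq Int_Un_distrib)
  have Tac_J: "Tac \<inter> ?J = {}"
    using disjT[OF Tac(4) Lb] disjT[OF Tac(4) Ld] disjT[OF Tac(4) Le] Tac(3)
    by (simp add: neq Int_Un_distrib)
  have Tba_J: "Tba \<inter> ?J = {}"
    using disjT[OF Tba(4) La] disjT[OF Tba(4) Ld] disjT[OF Tba(4) Le] Tba(3)
    by (simp add: neq Int_Un_distrib)
  have Tbc_J: "Tbc \<inter> ?J = {}"
    using disjT[OF Tbc(4) La] disjT[OF Tbc(4) Ld] disjT[OF Tbc(4) Le] Tbc(3)
    by (simp add: neq Int_Un_distrib)
  have Tde_J: "Tde \<inter> ?J = {}"
    using disjT[OF Tde(4) La] disjT[OF Tde(4) Lb] disjT[OF Tde(4) Le] Tde(3)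
    by (simp add: neq Int_Un_distrib)
  have Tdc_J: "Tdc \<inter> ?J = {}"
    using disjT[OF Tdc(4) La] disjT[OF Tdc(4) Lb] disjT[OF Tdc(4) Le] Tdc(3)
    by (simp add: neq Int_Un_distrib)
  have Ted_J: "Ted \<inter> ?J = {}"
    using disjT[OF Ted(4) La] disjT[OF Ted(4) Lb] disjT[OF Ted(4) Ld] Ted(3)
    by (simp add: neq Int_Un_distrib)
  have Tec_J: "Tec \<inter> ?J = {}"
    using disjT[OF Tec(4) La] disjT[OF Tec(4) Lb] disjT[OF Tec(4) Ld] Tec(3)
    by (simp add: neq Int_Un_distrib)
  have "L ` ?J \<subseteq> {{a}, {a, e}, {a, d}} \<union> {{d}, {d, a}, {d, b}} \<union>
      {{b}, {b, d}, {b, e}} \<union> {{e}, {e, b}, {e, a}}"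
    unfolding image_Un by (intro Un_mono La Lb Ld Le)
  then have "C0 \<inter> ?J = {}"
    by (rule sep[OF LC0]) (simp add: neq)
  then have AJ: "A \<inter> ?J = {}" and BJ: "B \<inter> ?J = {}" and CJ: "C \<inter> ?J = {}"
    unfolding A_def B_def C_def C1_def C2_def Int_Un_distrib2
    by (simp_all only: Tab_J Tba_J Tde_J Ted_J Tac_J Tbc_J Tdc_J Tec_J Un_empty_left)
  \<comment> \<open>\<open>SA\<close> joins the arcs in \<open>a\<close> and \<open>b\<close>
    through \<open>A\<close>; the landing points of the tails are added to make it compact. It is
    the barrier \<open>S\<close> of the crossing lemma, and the arcs in \<open>d\<close> and
    \<open>e\<close> cover the rest of the curve. \<open>SB\<close> is the same with the two pairs
    of regions exchanged.\<close>
  define SA where "SA = (path_image ga \<union> insert yab Tab) \<union> (path_image gb \<union> insert yba Tba)"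
  have SA: "compact SA" "connected SA" "SA \<subseteq> ?J \<union> A"
      "path_image ga \<subseteq> SA" "path_image gb \<subseteq> SA"
  proof -
    show "compact SA"
      using ga(1) gb(1) Tab(8) Tba(8) unfolding SA_def
      by (intro compact_Un) (auto intro: compact_arc_image)
    show "connected SA"
      using ga(1) gb(1) Tab(2,5,9) Tba(2,5,9) sym[of a b] I unfolding SA_def
      by (intro connected_Un) (auto intro: connected_arc_image)
    show "SA \<subseteq> ?J \<union> A"
      using Tab(5) Tba(5) unfolding SA_def A_def by auto
  qed (auto simp: SA_def)
  have LSA: "L ` SA \<subseteq> ({{a}, {a, e}, {a, d}} \<union> {{a}, {a, b}}) \<union> ({{b}, {b, d}, {b, e}} \<union> {{b}, {b, a}})"
    unfolding SA_def image_Un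
    by (intro Un_mono La Lb) (simp_all add: Tab(4,6) Tba(4,6))
  define SB where "SB = (path_image gd \<union> insert yde Tde) \<union> (path_image ge \<union> insert yed Ted)"
  have SB: "compact SB" "connected SB" "SB \<subseteq> ?J \<union> B"
      "path_image gd \<subseteq> SB" "path_image ge \<subseteq> SB"
  proof -
    show "compact SB"
      using gd(1) ge(1) Tde(8) Ted(8) unfolding SB_def
      by (intro compact_Un) (auto intro: compact_arc_image)
    show "connected SB"
      using gd(1) ge(1) Tde(2,5,9) Ted(2,5,9) sym[of d e] I unfolding SB_def
      by (intro connected_Un) (auto intro: connected_arc_image)
    show "SB \<subseteq> ?J \<union> B"
      using Tde(5) Ted(5) unfolding SB_def B_def by auto
  qed (auto simp: SB_def)
  have LSB: "L ` SB \<subseteq> ({{d}, {d, a}, {d, b}} \<union> {{d}, {d, e}}) \<union> ({{e}, {e, b}, {e, a}} \<union> {{e}, {e, d}})"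
    unfolding SB_def image_Un
    by (intro Un_mono Ld Le) (simp_all add: Tde(4,6) Ted(4,6))
  \<comment> \<open>A side that misses \<open>A\<close> also misses \<open>SA\<close>, which
    consists of points of the curve and of \<open>A\<close>. The disjoint arcs in \<open>d\<close>
    and \<open>e\<close> serve as \<open>P\<close> and \<open>Q\<close>, and \<open>B\<close>
    touches them at points labelled \<open>{d}\<close> and \<open>{e}\<close>, labels that do not
    occur on \<open>SA\<close>.\<close>
  have noAB: "B \<inter> X \<noteq> {}" if "A \<inter> X = {}" "X \<in> components (- ?J)" "?J \<subseteq> closure X" for X
  proof (rule crossing_connected_sets_meet
      [where P = "path_image gd" and Q = "path_image ge" and S = SA and J = ?J])
    show "SA \<inter> X = {}" using SA(3) that in_components_subset by blast
    show "B \<inter> SA = {}"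
      by (rule sep[OF LB LSA]) (simp add: neq)
    show "B \<inter> ?J = {}"
      using AJ BJ CJ unfolding C_def by blast
    show "compact (path_image gd)" "compact (path_image ge)"
      using gd(1) ge(1) by (simp_all add: compact_arc_image)
    show "?J \<subseteq> path_image gd \<union> path_image ge \<union> SA" using SA(4,5) by blast
    show "path_image gd \<inter> path_image ge \<subseteq> SA" using ab de by blast
    show "yde \<in> path_image gd" "yed \<in> path_image ge" using Tde(5) Ted(5) by auto
    show "yde \<in> closure B" "yed \<in> closure B"
      using Tde(7) Ted(7) closure_mono[of Tde B] closure_mono[of Ted B]
      unfolding B_def by auto
    have "yde \<notin> SA" "yed \<notin> SA"
      by (rule not_in[OF LSA], simp add: neq Tde(6) Ted(6))+
    then show "yde \<notin> path_image ge \<union> SA" "yed \<notin> path_image gd \<union> SA"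
      using Tde(5) Ted(5) ab de by auto
  qed (use that SA conn connC in auto)
  have noAC2: "C2 \<inter> X \<noteq> {}" if "A \<inter> X = {}" "X \<in> components (- ?J)" "?J \<subseteq> closure X" for X
  proof (rule crossing_connected_sets_meet
      [where P = "path_image gd" and Q = "path_image ge" and S = SA and J = ?J])
    show "SA \<inter> X = {}" using SA(3) that in_components_subset by blast
    show "C2 \<inter> SA = {}"
      by (rule sep[OF LC2 LSA]) (simp add: neq)
    show "C2 \<inter> ?J = {}"
      using AJ BJ CJ unfolding C_def by blast
    show "compact (path_image gd)" "compact (path_image ge)"
      using gd(1) ge(1) by (simp_all add: compact_arc_image)
    show "?J \<subseteq> path_image gd \<union> path_image ge \<union> SA" using SA(4,5) by blast
    show "path_image gd \<inter> path_image ge \<subseteq> SA" using ab de by blast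
    show "ydc \<in> path_image gd" "yec \<in> path_image ge" using Tdc(5) Tec(5) by auto
    show "ydc \<in> closure C2" "yec \<in> closure C2"
      using Tdc(7) Tec(7) closure_mono[of Tdc C2] closure_mono[of Tec C2]
      unfolding C2_def by auto
    have "ydc \<notin> SA" "yec \<notin> SA"
      by (rule not_in[OF LSA], simp add: neq Tdc(6) Tec(6))+
    then show "ydc \<notin> path_image ge \<union> SA" "yec \<notin> path_image gd \<union> SA"
      using Tdc(5) Tec(5) ab de by auto
  qed (use that SA conn connC in auto)
  \<comment> \<open>Here the pairs are exchanged: \<open>SB\<close> is the barrier, and
    \<open>C1\<close> touches the arcs in \<open>a\<close> and \<open>b\<close>.\<close>
  have noBC1: "C1 \<inter> X \<noteq> {}" if "B \<inter> X = {}" "X \<in> components (- ?J)" "?J \<subseteq> closure X" for X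
  proof (rule crossing_connected_sets_meet
      [where P = "path_image ga" and Q = "path_image gb" and S = SB and J = ?J])
    show "SB \<inter> X = {}" using SB(3) that in_components_subset by blast
    show "C1 \<inter> SB = {}"
      by (rule sep[OF LC1 LSB]) (simp add: neq)
    show "C1 \<inter> ?J = {}"
      using AJ BJ CJ unfolding C_def by blast
    show "compact (path_image ga)" "compact (path_image gb)"
      using ga(1) gb(1) by (simp_all add: compact_arc_image)
    show "?J \<subseteq> path_image ga \<union> path_image gb \<union> SB" using SB(4,5) by blast
    show "path_image ga \<inter> path_image gb \<subseteq> SB" using ab de by blast
    show "yac \<in> path_image ga" "ybc \<in> path_image gb" using Tac(5) Tbc(5) by auto
    show "yac \<in> closure C1" "ybc \<in> closure C1"
      using Tac(7) Tbc(7) closure_mono[of Tac C1] closure_mono[of Tbc C1]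
      unfolding C1_def by auto
    have "yac \<notin> SB" "ybc \<notin> SB"
      by (rule not_in[OF LSB], simp add: neq Tac(6) Tbc(6))+
    then show "yac \<notin> path_image gb \<union> SB" "ybc \<notin> path_image ga \<union> SB"
      using Tac(5) Tbc(5) ab de by auto
  qed (use that SB conn connC in auto)
  \<comment> \<open>No two of A, B, C lie on the same side of the curve, but there are only two sides.\<close>
  have side: "K \<inter> R = {} \<or> K \<inter> R' = {}" if "connected K" "K \<inter> ?J = {}" for K
  proof -
    have "K \<subseteq> - ?J" using that(2) by blast
    then show ?thesis
      using components_maximal[OF R(1) that(1)] components_maximal[OF R(2) that(1)] R(5) by blast
  qed
  have "A \<inter> R = {} \<or> A \<inter> R' = {}" "B \<inter> R = {} \<or> B \<inter> R' = {}" "C \<inter> R = {} \<or> C \<inter> R' = {}"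
    using side[OF conn(1) AJ] side[OF conn(2) BJ] side[OF \<open>connected C\<close> CJ] by simp_all
  moreover have "B \<inter> X \<noteq> {}" "C \<inter> X \<noteq> {}" if "A \<inter> X = {}" "X = R \<or> X = R'" for X
    using noAB[of X] noAC2[of X] that R(1-4) unfolding C_def by auto
  moreover have "C \<inter> X \<noteq> {}" if "B \<inter> X = {}" "X = R \<or> X = R'" for X
    using noBC1[of X] that R(1-4) unfolding C_def by auto
  \<comment> \<open>\<open>A\<close> misses some side. Then \<open>B\<close> and \<open>C\<close>
    both meet that side, so both miss the other one; but if \<open>B\<close> misses the other side,
    then \<open>C\<close> must meet it.\<close>
  ultimately show False by metis
qed

section \<open>Accessibility of the midpoint of an edge from an incident face\<close>

lemma aff_dim_polyhedron_edge: "polyhedron_edge V e \<Longrightarrow> aff_dim e = 1"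
  unfolding polyhedron_edge_def
  by (metis aff_dim_2 aff_dim_affine_hull affine_hull_open_segment)

text \<open>The vertices and the other edges stay at a positive distance from the midpoint, so near
  it the frontier of \<open>f\<close> lies on this edge. A nearby point \<open>q\<close> of the face
  is off the line carrying the edge, so the segment from \<open>q\<close> to the midpoint meets the
  edge only at its end and runs inside the face until then.\<close>

lemma path_connected_insert_midpoint:
  assumes "finite V" "finite E" and edges: "\<forall>e\<in>E. polyhedron_edge V e"
    and face: "polyhedron_face V E f"
    and ab: "a \<noteq> b" "open_segment a b \<subseteq> closure f" "open_segment a b \<inter> f = {}"
    and off: "open_segment a b \<inter> (V \<union> \<Union>(E - {open_segment a b})) = {}"
  shows "path_connected (insert (midpoint a b) f)"
proof -
  let ?e = "open_segment a b" and ?m = "midpoint a b"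
  let ?K = "V \<union> \<Union>(E - {?e})"
  have m: "?m \<in> ?e" using \<open>a \<noteq> b\<close> by simp
  \<comment> \<open>\<open>?K\<close> is closed although its edges are open segments, because their
    endpoints are vertices.\<close>
  have "closure e' \<subseteq> V \<union> e'" if "e' \<in> E" for e'
    using edges that by (auto simp: polyhedron_edge_def closed_segment_eq_open)
  then have "?K = V \<union> (\<Union>e'\<in>E - {?e}. closure e')"
    using closure_subset by blast
  also have "closed \<dots>"
    using \<open>finite V\<close> \<open>finite E\<close> by (intro closed_Un closed_UN) (auto intro: finite_imp_closed)
  finally have "open (- ?K)" by blast
  moreover have "?m \<in> - ?K" using m off by blast
  ultimately obtain r where r: "r > 0" "ball ?m r \<subseteq> - ?K"
    using open_contains_ball by blast
  \<comment> \<open>The bound \<open>r\<close> keeps the segment from \<open>q\<close> to the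
    midpoint away from \<open>?K\<close>. Half the edge length ensures that \<open>q\<close>, if it
    were on the line through \<open>a\<close> and \<open>b\<close>, would lie strictly between
    them.\<close>
  have "min r (norm (b - a) / 2) > 0" using r \<open>a \<noteq> b\<close> by simp
  then obtain q where q: "q \<in> f" "dist q ?m < min r (norm (b - a) / 2)"
    using ab(2) m unfolding closure_approachable[of ?m f] subset_iff closure_approachable by metis
  let ?X = "insert q (open_segment q ?m)"
  let ?P = "affine hull f"
  have "q \<noteq> ?m" using m ab(3) q(1) by blast
  have "connected ?X"
  proof (rule connected_intermediate_closure)
    show "connected (open_segment q ?m)"
      by (simp add: convex_connected)
    show "?X \<subseteq> closure (open_segment q ?m)"
      using \<open>q \<noteq> ?m\<close> by (simp add: open_closed_segment subset_iff)
  qed blast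
  have fP: "closure f \<subseteq> ?P"
    by (simp add: closure_minimal hull_subset closed_affine_hull)
  have XP: "?X \<subseteq> ?P"
  proof -
    have "closed_segment q ?m \<subseteq> ?P"
    proof (rule closed_segment_subset)
      show "q \<in> ?P" using q(1) by (rule hull_inc)
      show "?m \<in> ?P" using m ab(2) fP by blast
    qed (simp add: affine_imp_convex)
    then show ?thesis using open_closed_segment by fastforce
  qed
  have X_front: "x \<notin> closure f - f" if "x \<in> ?X" for x
  proof
    assume x: "x \<in> closure f - f"
    with that q(1) have xseg: "x \<in> open_segment q ?m" by auto
    then have "dist x ?m < dist q ?m"
      by (simp add: dist_in_open_segment dist_commute)
    then have "x \<notin> ?K" using r(2) q(2) by (auto simp: dist_commute subset_iff)
    moreover have "x \<in> V \<union> \<Union>E"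
      using x face unfolding polyhedron_face_def by blast
    ultimately have "x \<in> ?e" by auto
    then obtain t where t: "x = (1 - t) *\<^sub>R a + t *\<^sub>R b" by (auto simp: in_segment)
    obtain u where u: "0 < u" "u < 1" "x = (1 - u) *\<^sub>R q + u *\<^sub>R ?m"
      using xseg by (auto simp: in_segment)
    \<comment> \<open>The line through \<open>x\<close> and the midpoint carries the edge, so \<open>q\<close>, being close to the midpoint,
      would lie on the edge as well.\<close>
    define s where "s = (t - u / 2) / (1 - u)"
    have s: "s * (1 - u) = t - u / 2" using u by (simp add: s_def)
    have "(1 - u) *\<^sub>R q = (1 - t) *\<^sub>R a + t *\<^sub>R b - u *\<^sub>R ?m"
      using t u(3) by (simp add: algebra_simps)
    also have "\<dots> = (1 - u) *\<^sub>R a + (s * (1 - u)) *\<^sub>R (b - a)"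
      unfolding s by (simp add: vec_eq_iff midpoint_def field_simps)
    also have "\<dots> = (1 - u) *\<^sub>R (a + s *\<^sub>R (b - a))"
      by (simp add: algebra_simps)
    finally have qs: "q = a + s *\<^sub>R (b - a)" using u by simp
    have "q - ?m = (s - 1 / 2) *\<^sub>R (b - a)"
      unfolding qs by (simp add: vec_eq_iff midpoint_def field_simps)
    then have "dist q ?m = \<bar>s - 1 / 2\<bar> * norm (b - a)"
      by (simp add: dist_norm)
    with q(2) have "\<bar>s - 1 / 2\<bar> * norm (b - a) < 1 / 2 * norm (b - a)" by simp
    then have "\<bar>s - 1 / 2\<bar> < 1 / 2" by (simp only: mult_less_cancel_right) auto
    then have "0 < s" "s < 1" by linarith+
    moreover have "q = (1 - s) *\<^sub>R a + s *\<^sub>R b" using qs by (simp add: algebra_simps)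
    ultimately have "q \<in> ?e" using \<open>a \<noteq> b\<close> by (auto simp: in_segment)
    then show False using q(1) ab(3) by auto
  qed
  \<comment> \<open>Since \<open>f\<close> is open in its plane, \<open>U\<close> and the complement
    of \<open>closure f\<close> cover the plane except for the frontier of the face. The connected
    set \<open>?X\<close> avoids that frontier and contains \<open>q\<close>, so it stays in
    \<open>f\<close>.\<close>
  have "openin (top_of_set ?P) f" using face by (simp add: polyhedron_face_def)
  then obtain U where U: "open U" "f = ?P \<inter> U" by (auto simp: openin_open)
  have "U \<inter> ?X = {} \<or> (- closure f) \<inter> ?X = {}"
    using connectedD[OF \<open>connected ?X\<close> U(1), of "- closure f"] U(2) XP X_front closure_subset[of f]
    by auto
  then have "?X \<subseteq> f" using X_front U(2) q(1) by blast
  then have "insert ?m f = f \<union> closed_segment q ?m"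
    using q(1) by (auto simp: closed_segment_eq_open)
  moreover have "path_connected f"
    using face homeomorphic_path_connectedness convex_imp_path_connected[OF convex_ball]
    unfolding polyhedron_face_def by blast
  ultimately show ?thesis
    using q(1) by (auto intro!: path_connected_Un)
qed

section \<open>Colouring: needing as many colours as faces forces adjacency\<close>

text \<open>If \<open>f\<close> and \<open>g\<close> were not adjacent, \<open>g\<close> could share
  the colour of \<open>f\<close> while all other faces get colours of their own, which saves one
  colour.\<close>

lemma requires_card_imp_adjacent:
  assumes "finite G" "requires_colours E G (card G)" "f \<in> G" "g \<in> G" "f \<noteq> g"
  shows "adjacent_faces E f g"
proof (rule ccontr)
  assume nadj: "\<not> adjacent_faces E f g"
  then have nadj': "\<not> adjacent_faces E g f" by (auto simp: adjacent_faces_def)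
  obtain c where c: "bij_betw c (G - {g}) {0..<card (G - {g})}"
    using ex_bij_betw_finite_nat[of "G - {g}"] \<open>finite G\<close> by auto
  define c' where "c' = c(g := c f)"
  have "c h < card (G - {g})" if "h \<in> G - {g}" for h
    using c that by (auto simp: bij_betw_def)
  then have "\<forall>h\<in>G. c' h < card (G - {g})"
    using assms by (auto simp: c'_def)
  moreover have "c' h \<noteq> c' k" if "h \<in> G" "k \<in> G" "adjacent_faces E h k" for h k
  proof -
    have "h \<noteq> k" using that by (auto simp: adjacent_faces_def)
    moreover have "h \<noteq> g \<or> k \<noteq> f" "h \<noteq> f \<or> k \<noteq> g" using that nadj nadj' by auto
    moreover have "inj_on c (G - {g})" using c by (simp add: bij_betw_def)
    ultimately show ?thesis using that assms by (auto simp: c'_def inj_on_eq_iff)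
  qed
  ultimately have "face_colourable E G (card (G - {g}))"
    unfolding face_colourable_def by blast
  moreover have "card (G - {g}) < card G"
    using assms by (meson card_Diff1_less)
  ultimately show False
    using assms(2) by (auto simp: requires_colours_def)
qed

section \<open>From the surface of the polyhedron to the plane\<close>

theorem theorem3p3:
  "\<not> (\<exists>V E G. polyhedral_graph V E G \<and> card G = 5 \<and> requires_colours E G 5)"
proof
  assume "\<exists>V E G. polyhedral_graph V E G \<and> card G = 5 \<and> requires_colours E G 5"
  then obtain V E G F u where G: "card G = 5" "requires_colours E G 5" "G = F - {u}" "u \<in> F"
    and poly: "spherical_polyhedron V E F"
    unfolding polyhedral_graph_def by blast
  have fin: "finite V" "finite E" "finite F"
    and edge: "\<forall>e\<in>E. polyhedron_edge V e"
    and face: "\<And>f. f \<in> F \<Longrightarrow> polyhedron_face V E f"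
    and pw: "pairwise disjnt ((\<lambda>v. {v}) ` V \<union> E \<union> F)"
    and two: "\<And>e. e \<in> E \<Longrightarrow> card {f \<in> F. e \<subseteq> closure f} = 2"
    and sphere: "(V \<union> \<Union>E \<union> \<Union>F) homeomorphic sphere (0::real^3) 1"
    using poly unfolding spherical_polyhedron_def by auto
  \<comment> \<open>Pairwise disjointness speaks only of distinct members of the partition, so
    vertices, edges and faces must first be told apart; their affine dimensions 0, 1 and 2 do
    this.\<close>
  have ndim: "e \<noteq> {v}" "f \<noteq> e" if "e \<in> E" "f \<in> F" for e f v
    using that aff_dim_polyhedron_edge[of V e] edge face[of f]
    by (auto simp: polyhedron_face_def)
  have disj: "X \<inter> Y = {}" if "X \<in> E \<union> F" "Y \<in> E \<union> F" "X \<noteq> Y" for X Y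
    using pairwiseD[OF pw, of X Y] that unfolding disjnt_def by blast
  have Ve: "e \<inter> V = {}" if "e \<in> E" for e
  proof -
    have "{v} \<inter> e = {}" if "v \<in> V" for v
      using pairwiseD[OF pw, of "{v}" e] that \<open>e \<in> E\<close> ndim(1)[OF \<open>e \<in> E\<close> \<open>u \<in> F\<close>, of v]
      unfolding disjnt_def by (metis UnI1 UnI2 imageI)
    then show ?thesis by blast
  qed
  \<comment> \<open>One point of the edge has to serve every face along it, so the midpoint is
    chosen before the face.\<close>
  have "\<exists>z\<in>e. \<forall>f\<in>F. e \<subseteq> closure f \<longrightarrow> path_connected (insert z f)" if "e \<in> E" for e
  proof -
    have "polyhedron_edge V e" using edge that by blast
    then obtain a b where ab: "a \<noteq> b" "e = open_segment a b"
      unfolding polyhedron_edge_def by blast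
    have "path_connected (insert (midpoint a b) f)" if "f \<in> F" "e \<subseteq> closure f" for f
    proof (rule path_connected_insert_midpoint[OF fin(1,2) edge face[OF that(1)] ab(1)])
      show "open_segment a b \<subseteq> closure f" using that ab by simp
      show "open_segment a b \<inter> f = {}"
        using disj[of e f] ndim(2)[of e f] that \<open>e \<in> E\<close> ab by blast
      show "open_segment a b \<inter> (V \<union> \<Union>(E - {open_segment a b})) = {}"
        using Ve[OF \<open>e \<in> E\<close>] disj[of e] \<open>e \<in> E\<close> ab(2) by blast
    qed
    then show ?thesis using ab by (intro bexI[of _ "midpoint a b"]) auto
  qed
  then obtain z where z: "\<And>e. e \<in> E \<Longrightarrow> z e \<in> e"
    "\<And>e f. \<lbrakk>e \<in> E; f \<in> F; e \<subseteq> closure f\<rbrakk> \<Longrightarrow> path_connected (insert (z e) f)"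
    by metis
  \<comment> \<open>Choosing from the unordered pair makes \<open>common\<close> symmetric.\<close>
  define common where "common f g = (SOME e. e \<in> E \<and> (\<forall>h\<in>{f, g}. e \<subseteq> closure h))" for f g
  have common: "common f g \<in> E" "common f g \<subseteq> closure f" "common f g \<subseteq> closure g"
    if "f \<in> G" "g \<in> G" "f \<noteq> g" for f g
  proof -
    have "finite G" using fin G by simp
    then have "\<exists>e\<in>E. e \<subseteq> closure f \<and> e \<subseteq> closure g"
      using requires_card_imp_adjacent[of G E f g] G that by (auto simp: adjacent_faces_def)
    then have "\<exists>e. e \<in> E \<and> (\<forall>h\<in>{f, g}. e \<subseteq> closure h)" by auto
    from someI_ex[OF this] show "common f g \<in> E" "common f g \<subseteq> closure f" "common f g \<subseteq> closure g"
      unfolding common_def by auto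
  qed
  \<comment> \<open>An edge borders exactly two faces, so a common edge determines the pair of faces
    that it was chosen for.\<close>
  have sides: "{f, g} = {h \<in> F. common f g \<subseteq> closure h}" if "f \<in> G" "g \<in> G" "f \<noteq> g" for f g
  proof (rule card_subset_eq)
    show "card {f, g} = card {h \<in> F. common f g \<subseteq> closure h}"
      using two common that by simp
  qed (use fin G common that in auto)
  define M where "M = V \<union> \<Union>E \<union> \<Union>F"
  have "u \<noteq> {}" using face[OF \<open>u \<in> F\<close>] by (auto simp: polyhedron_face_def)
  then obtain p where p: "p \<in> u" by blast
  have "p \<in> M" using p \<open>u \<in> F\<close> M_def by blast
  obtain h k where hk: "homeomorphism M (sphere (0::real^3) 1) h k"
    using sphere by (auto simp: M_def homeomorphic_def)
  have hp: "h p \<in> sphere 0 1" using hk \<open>p \<in> M\<close> unfolding homeomorphism_def by blast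
  have "inj_on h M" using homeomorphism_apply1[OF hk] by (rule inj_on_inverseI)
  then have "h ` (M - {p}) = sphere 0 1 - {h p}"
    using inj_on_image_set_diff[of h M M "{p}"] \<open>p \<in> M\<close> homeomorphism_image1[OF hk] by simp
  then have "M - {p} homeomorphic sphere 0 1 - {h p}"
    using homeomorphism_of_subsets[OF hk Diff_subset Diff_subset] unfolding homeomorphic_def by metis
  also have "sphere 0 1 - {h p} homeomorphic (UNIV :: complex set)"
    using hp by (intro homeomorphic_punctured_sphere_affine) auto
  finally obtain \<phi> \<psi> where hom: "homeomorphism (M - {p}) (UNIV :: complex set) \<phi> \<psi>"
    unfolding homeomorphic_def by blast
  have cont: "continuous_on (M - {p}) \<phi>"
    using hom by (rule homeomorphism_cont1)
  have inj: "inj_on \<phi> (M - {p})"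
    using homeomorphism_apply1[OF hom] by (rule inj_on_inverseI)
  \<comment> \<open>The puncture lies in the undersurface, which is disjoint from all edges and from
    the remaining faces, so these survive in the plane.\<close>
  have p_off: "p \<notin> X" if "X \<in> E \<union> G" for X
    using disj[of X u] ndim(2)[of X u] that p G by blast
  have sub_f: "f \<subseteq> M - {p}" if "f \<in> G" for f
    using that p_off[of f] G M_def by blast
  have sub_z: "z (common f g) \<in> M - {p}" if "f \<in> G" "g \<in> G" "f \<noteq> g" for f g
    using z(1) common(1)[OF that] p_off M_def by blast
  show False
  proof (rule no_complete_five_contact_in_plane[where I = G and f = "(`) \<phi>"
        and m = "\<lambda>f g. \<phi> (z (common f g))"])
    show "card G = 5" by (rule G)
    fix f assume f: "f \<in> G"
    show "\<phi> ` f \<noteq> {}" using face[of f] f G by (auto simp: polyhedron_face_def)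
    have "path_connected f"
      using face[of f] f G homeomorphic_path_connectedness convex_imp_path_connected[OF convex_ball]
      unfolding polyhedron_face_def by blast
    then show "path_connected (\<phi> ` f)"
      by (rule path_connected_continuous_image[OF continuous_on_subset[OF cont sub_f[OF f]]])
    fix g assume g: "g \<in> G"
    show "\<phi> (z (common f g)) = \<phi> (z (common g f))"
      by (simp add: common_def insert_commute)
    show "path_connected (insert (\<phi> (z (common f g))) (\<phi> ` f))" if "f \<noteq> g"
    proof -
      have "path_connected (insert (z (common f g)) f)"
        using z(2) common[OF f g that] f G by blast
      moreover have "insert (z (common f g)) f \<subseteq> M - {p}"
        using sub_f[OF f] sub_z[OF f g that] by blast
      ultimately have "path_connected (\<phi> ` insert (z (common f g)) f)"
        by (meson path_connected_continuous_image continuous_on_subset cont)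
      then show ?thesis by simp
    qed
    show "\<phi> ` f \<inter> \<phi> ` g = {}" if "f \<noteq> g"
      using inj_on_image_Int[OF inj sub_f[OF f] sub_f[OF g]] disj[of f g] that f g G by auto
    fix f' assume f': "f' \<in> G"
    show "\<phi> (z (common f g)) \<notin> \<phi> ` f'" if "f \<noteq> g"
    proof -
      have "z (common f g) \<notin> f'"
        using z(1) common(1)[OF f g that] disj[of "common f g" f'] ndim(2)[of "common f g" f'] f' G
        by blast
      then show ?thesis
        using inj_on_image_mem_iff[OF inj sub_z[OF f g that] sub_f[OF f']] by simp
    qed
    fix g' assume g': "g' \<in> G"
    show "{f, g} = {f', g'}" if neq: "f \<noteq> g" "f' \<noteq> g'"
      and eq: "\<phi> (z (common f g)) = \<phi> (z (common f' g'))"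
    proof -
      \<comment> \<open>A contact point determines its edge, as distinct edges are disjoint, and the
        edge determines the two faces.\<close>
      have "z (common f g) = z (common f' g')"
        using inj_onD[OF inj eq] sub_z[OF f g neq(1)] sub_z[OF f' g' neq(2)] by simp
      then have "common f g \<inter> common f' g' \<noteq> {}"
        using z(1)[OF common(1)[OF f g neq(1)]] z(1)[OF common(1)[OF f' g' neq(2)]] by auto
      then have "common f g = common f' g'"
        using disj common(1)[OF f g neq(1)] common(1)[OF f' g' neq(2)] by blast
      then show ?thesis
        using sides[OF f g neq(1)] sides[OF f' g' neq(2)] by simp
    qed
  qed
qed

end
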